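(* Let $\mathcal{D}\subseteq\mathbb{R}^n$ be open and convex, let $f\colon\mathcal{D}\to\mathcal{D}$ be a convex monotone map and let $v,w\in\mathcal{D}$ be t-stable fixed points of $f$. If $v_i=w_i$ for all $i\in S$, where $S\subseteq\{1,\ldots,n\}$ is a set that contains at least one node of each strongly connected component of the critical graph $\mathcal{G}^c(f)$, then $v=w$. In particular, if $f$ has a t-stable fixed point and $N^c(f)$ is empty, then the t-stable fixed point is unique.
   Context: Order on $\mathbb{R}^n$: $x\leq y$ iff $x_i\leq y_i$ for all $i$. A map $f\colon\mathcal{D}\to\mathbb{R}^n$ is monotone if $x\leq y$ implies $f(x)\leq f(y)$, and convex if each coordinate function is convex. t-stability: for a convex map $f$ on an open convex set and $v\in\mathcal{D}$, let $f'_v(y)=\lim_{\epsilon\downarrow 0}(f(v+\epsilon y)-f(v))/\epsilon$ for $y\in\mathbb{R}^n$. A fixed point $v$ of $f$ is tangentially stable (t-stable) if every orbit $\{(f'_v)^k(y)\colon k\geq 0\}$, $y\in\mathbb{R}^n$, is bounded from above with respect to $\leq$. Subdifferential: $\partial f(v)$ is the set of real $n\times n$ matrices $M$ with $f(x)-f(v)\geq M(x-v)$ for all $x\in\mathcal{D}$. If $v$ is a t-stable fixed point of a convex monotone map $f$, then all matrices in $\partial f(v)$ are nonnegative and stable, where a matrix $P$ is stable if all orbits $\{P^kx\colon k\ge 0\}$ are bounded. Critical graph: for a nonnegative $n\times n$ matrix $P$, $\mathcal{G}(P)$ is the directed graph on $\{1,\ldots,n\}$ with an arrow from $i$ to $j$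 iff $p_{ij}>0$; the classes of $P$ are the equivalence classes of the relation "$i$ has access to $j$ and $j$ has access to $i$" (access = existence of a directed path; each node has access to itself). If $P$ is stable, a class $K$ is critical if the submatrix $P_{KK}$ has spectral radius $1$; $N^c(P)$ is the union of the critical classes and $\mathcal{G}^c(P)$ is the restriction of $\mathcal{G}(P)$ to the nodes in $N^c(P)$. For a set $\mathcal{P}$ of stable nonnegative matrices, $N^c(\mathcal{P})=\bigcup_{P\in\mathcal{P}}N^c(P)$ and $\mathcal{G}^c(\mathcal{P})=\bigcup_{P\in\mathcal{P}}\mathcal{G}^c(P)$. If $f$ has a t-stable fixed point $v$, one puts $N^c(f)=N^c(\partial f(v))$ and $\mathcal{G}^c(f)=\mathcal{G}^c(\partial f(v))$; these do not depend on the choice of the t-stable fixed point $v$. *)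

theory Defs
  imports
    "HOL-Analysis.Analysis"
    "Jordan_Normal_Form.Spectral_Radius"
    "Graph_Theory.Graph_Theory"
begin

(* Keep "$" for the components of real^'n. *)
no_notation Matrix.vec_index (infixl "$" 100)

(* The order on real^'n is the componentwise order of the library. *)
definition convex_map_on :: "(real^'n::finite) set \<Rightarrow> (real^'n \<Rightarrow> real^'n) \<Rightarrow> bool" where
  "convex_map_on D f \<longleftrightarrow> (\<forall>i. convex_on D (\<lambda>x. f x $ i))"

(* For f convex on an open convex set containing v the one-sided limit exists for every y,
   so the total operator Lim does not return a default value. *)
definition dir_deriv :: "(real^'n::finite \<Rightarrow> real^'n) \<Rightarrow> real^'n \<Rightarrow> real^'n \<Rightarrow> real^'n" where
  "dir_deriv f v y = Lim (at_right 0) (\<lambda>\<epsilon>::real. (f (v + \<epsilon> *\<^sub>R y) - f v) /\<^sub>R \<epsilon>)"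

definition t_stable_fixed_point ::
    "(real^'n::finite) set \<Rightarrow> (real^'n \<Rightarrow> real^'n) \<Rightarrow> real^'n \<Rightarrow> bool" where
  "t_stable_fixed_point D f v \<longleftrightarrow>
     v \<in> D \<and> f v = v \<and> (\<forall>y. bdd_above (range (\<lambda>k. (dir_deriv f v ^^ k) y)))"

definition subdifferential ::
    "(real^'n::finite) set \<Rightarrow> (real^'n \<Rightarrow> real^'n) \<Rightarrow> real^'n \<Rightarrow> (real^'n^'n) set" where
  "subdifferential D f v = {M. \<forall>x\<in>D. M *v (x - v) \<le> f x - f v}"

definition matrix_graph :: "real^'n^'n::finite \<Rightarrow> 'n pair_pre_digraph" where
  "matrix_graph P = \<lparr>pverts = UNIV, parcs = {(i, j). P $ i $ j > 0}\<rparr>"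

definition matrix_classes :: "real^'n^'n::finite \<Rightarrow> 'n set set" where
  "matrix_classes P = UNIV //
     {(i, j). reachable (matrix_graph P) i j \<and> reachable (matrix_graph P) j i}"

(* The principal submatrix with rows and columns in K. The library indexes matrices by initial
   segments of the natural numbers, so K has to be enumerated; another enumeration
   conjugates the result by a permutation matrix, which does not change its spectrum. *)
definition principal_submatrix :: "real^'n^'n::finite \<Rightarrow> 'n set \<Rightarrow> complex Matrix.mat" where
  "principal_submatrix P K =
     (let e = (SOME e. bij_betw e {0..<card K} K)
      in Matrix.mat (card K) (card K) (\<lambda>(a, b). complex_of_real (P $ e a $ e b)))"

(* Meant for nonnegative stable P. Stability is not repeated here: every matrix in the
   subdifferential of a convex monotone map at a t-stable fixed point is nonnegative and stable. *)
definition critical_classes :: "real^'n^'n::finite \<Rightarrow> 'n set set" where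
  "critical_classes P =
     {K \<in> matrix_classes P. spectral_radius (principal_submatrix P K) = 1}"

definition critical_nodes :: "real^'n^'n::finite \<Rightarrow> 'n set" where
  "critical_nodes P = \<Union> (critical_classes P)"

definition critical_graph :: "real^'n^'n::finite \<Rightarrow> 'n pair_pre_digraph" where
  "critical_graph P =
     \<lparr>pverts = critical_nodes P,
      parcs = parcs (matrix_graph P) \<inter> (critical_nodes P \<times> critical_nodes P)\<rparr>"

definition critical_nodes_set :: "(real^'n^'n::finite) set \<Rightarrow> 'n set" where
  "critical_nodes_set \<P> = (\<Union>P\<in>\<P>. critical_nodes P)"

definition critical_graph_set :: "(real^'n^'n::finite) set \<Rightarrow> 'n pair_pre_digraph" where
  "critical_graph_set \<P> =
     \<lparr>pverts = (\<Union>P\<in>\<P>. pverts (critical_graph P)), parcs = (\<Union>P\<in>\<P>. parcs (critical_graph P))\<rparr>"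

(* The critical nodes and the critical graph of f, computed at the t-stable fixed point u;
   they do not depend on u, so statements about them are made for an arbitrary such u. *)
definition critical_nodes_map ::
    "(real^'n::finite) set \<Rightarrow> (real^'n \<Rightarrow> real^'n) \<Rightarrow> real^'n \<Rightarrow> 'n set" where
  "critical_nodes_map D f u = critical_nodes_set (subdifferential D f u)"

definition critical_graph_map ::
    "(real^'n::finite) set \<Rightarrow> (real^'n \<Rightarrow> real^'n) \<Rightarrow> real^'n \<Rightarrow> 'n pair_pre_digraph" where
  "critical_graph_map D f u = critical_graph_set (subdifferential D f u)"

end

theory Submission
  imports Defs
begin

text \<open>
  For t-stable fixed points \<open>v\<close>, \<open>w\<close> put \<open>z = w - v\<close>. Every \<open>P\<close> in the subdifferential at \<open>v\<close> is
  nonnegative and stable and satisfies \<open>P *v z \<le> z\<close>. On a critical class this inequality is an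
  equality, both for \<open>z\<close> and for minus its negative part, so zeros of \<open>z\<close> spread along the arcs of
  the critical graph, and \<open>z\<close> vanishes on all critical nodes. If the negative part of \<open>z\<close> were
  nonzero, a final class of its support would be critical; hence \<open>v \<le> w\<close>, and \<open>w \<le> v\<close> by
  symmetry. The symmetry needs the critical graph to be independent of the fixed point: on critical
  nodes \<open>f\<close> is affine between two fixed points, so critical rows can be moved from one
  subdifferential to the other.
\<close>

section \<open>Stable nonnegative matrices\<close>

lemmas vec_le_iff = Finite_Cartesian_Product.less_eq_vec_def

definition stable :: "real^'n^'n::finite \<Rightarrow> bool" where
  "stable P \<longleftrightarrow> (\<forall>y. bounded (range (\<lambda>k. ((*v) P ^^ k) y)))"

lemma matrix_vector_mono:
  fixes P :: "real^'n::finite^'m::finite"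
  assumes "0 \<le> P" "x \<le> y"
  shows "P *v x \<le> P *v y"
  using assms
  by (auto simp: vec_le_iff matrix_vector_mult_def intro!: sum_mono mult_left_mono)

lemma matrix_vector_mult_minus: "P *v (- x) = - (P *v x)"
  for P :: "real^'n::finite^'m::finite"
  using linear_neg[OF matrix_vector_mul_linear] .

lemma iterate_mono:
  fixes P :: "real^'n^'n::finite"
  assumes "0 \<le> P" "x \<le> y"
  shows "((*v) P ^^ k) x \<le> ((*v) P ^^ k) y"
  by (induction k) (auto intro: matrix_vector_mono assms)

lemma linear_iterate: "linear ((*v) (P :: real^'n^'n::finite) ^^ k)"
proof (induction k)
  case 0
  show ?case by (simp add: id_def linear_iff)
next
  case (Suc k)
  then show ?case
    using linear_compose[OF Suc matrix_vector_mul_linear[of P]] by (simp add: o_def)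
qed

lemma stable_bound:
  assumes "stable P"
  obtains B where "\<And>k i. \<bar>(((*v) P ^^ k) y) $ i\<bar> \<le> B"
proof -
  obtain B where "\<And>k. norm (((*v) P ^^ k) y) \<le> B"
    using assms unfolding stable_def bounded_iff by (metis rangeI)
  then show ?thesis
    using that by (meson component_le_norm_cart order_trans)
qed

lemma stableI:
  fixes P :: "real^'n^'n::finite"
  assumes "\<And>y. \<exists>B. \<forall>k i. \<bar>(((*v) P ^^ k) y) $ i\<bar> \<le> B"
  shows "stable P"
  unfolding stable_def
proof
  fix y :: "real^'n"
  obtain B where B: "\<And>k i. \<bar>(((*v) P ^^ k) y) $ i\<bar> \<le> B"
    using assms by blast
  have "norm (((*v) P ^^ k) y) \<le> (\<Sum>i\<in>(UNIV :: 'n set). B)" for k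
    by (rule order_trans[OF norm_le_l1_cart sum_mono[OF B]])
  then show "bounded (range (\<lambda>k. ((*v) P ^^ k) y))"
    unfolding bounded_iff by blast
qed

text \<open>The orbit of \<open>Q\<close> at \<open>y\<close> is dominated entrywise by the orbit of
  \<open>P\<close> at the vector of absolute values of \<open>y\<close>. The intended
  \<open>Q\<close> is \<open>P\<close> with all entries outside a block set to zero.\<close>

lemma stable_submatrix:
  fixes P Q :: "real^'n^'n::finite"
  assumes "stable P" "0 \<le> Q" "Q \<le> P"
  shows "stable Q"
proof (rule stableI)
  fix y :: "real^'n"
  define x :: "real^'n" where "x = (\<chi> i. \<bar>y $ i\<bar>)"
  have P0: "0 \<le> P" using assms by order
  have "\<bar>(((*v) Q ^^ k) y) $ i\<bar> \<le> (((*v) P ^^ k) x) $ i" for k i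
  proof (induction k arbitrary: i)
    case 0
    then show ?case by (simp add: x_def)
  next
    case (Suc k)
    have "\<bar>(\<Sum>j\<in>UNIV. Q $ i $ j * ((((*v) Q ^^ k) y) $ j))\<bar>
        \<le> (\<Sum>j\<in>UNIV. \<bar>Q $ i $ j * ((((*v) Q ^^ k) y) $ j)\<bar>)"
      by (rule sum_abs)
    also have "\<dots> \<le> (\<Sum>j\<in>UNIV. P $ i $ j * ((((*v) P ^^ k) x) $ j))"
      unfolding abs_mult using assms(2,3) P0
      by (intro sum_mono mult_mono Suc.IH) (auto simp: vec_le_iff)
    finally show ?case by (simp add: matrix_vector_mul_component inner_vec_def)
  qed
  moreover obtain B where "\<And>k i. \<bar>(((*v) P ^^ k) x) $ i\<bar> \<le> B"
    using stable_bound[OF assms(1)] by blast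
  ultimately show "\<exists>B. \<forall>k i. \<bar>(((*v) Q ^^ k) y) $ i\<bar> \<le> B"
    by (meson abs_ge_self order_trans)
qed

text \<open>The iterates decrease by monotonicity and are bounded below by stability, so they
  converge in each coordinate; continuity makes the limit a fixed vector.\<close>

lemma superharmonic_converges:
  fixes P :: "real^'n^'n::finite"
  assumes P: "0 \<le> P" "stable P" and z: "P *v z \<le> z"
  obtains z' where "(\<lambda>k. ((*v) P ^^ k) z) \<longlonglongrightarrow> z'" "P *v z' = z'" "z' \<le> z"
proof -
  let ?s = "\<lambda>k. ((*v) P ^^ k) z"
  have step: "?s (Suc k) \<le> ?s k" for k
    using iterate_mono[OF P(1) z, of k] by (simp add: funpow_swap1)
  have dec: "decseq (\<lambda>k. ?s k $ i)" for i
    using step by (auto simp: decseq_Suc_iff vec_le_iff)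
  obtain B where B: "\<And>k i. \<bar>?s k $ i\<bar> \<le> B"
    using stable_bound[OF P(2)] by blast
  have "convergent (\<lambda>k. ?s k $ i)" for i
    using B dec by (intro Bseq_monoseq_convergent BseqI'[of _ B]) (auto simp: monoseq_iff)
  then have lim: "(\<lambda>k. ?s k $ i) \<longlonglongrightarrow> lim (\<lambda>k. ?s k $ i)" for i
    by (simp add: convergent_LIMSEQ_iff)
  define z' where "z' = (\<chi> i. lim (\<lambda>k. ?s k $ i))"
  have conv: "?s \<longlonglongrightarrow> z'"
    by (rule vec_tendstoI) (simp add: z'_def lim)
  have "(\<lambda>k. P *v ?s k) \<longlonglongrightarrow> P *v z'"
    using bounded_linear.tendsto[OF matrix_vector_mul_bounded_linear conv] .
  moreover have "(\<lambda>k. P *v ?s k) \<longlonglongrightarrow> z'"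
    using LIMSEQ_Suc[OF conv] by simp
  ultimately have "P *v z' = z'"
    by (rule LIMSEQ_unique)
  moreover have "z' \<le> z"
    using decseq_ge[OF dec lim, of _ 0] by (simp add: vec_le_iff z'_def)
  ultimately show ?thesis using that conv by blast
qed

section \<open>Access and classes in the graph of a matrix\<close>

lemma reachable_matrix_graph_step:
  assumes "P $ i $ j > 0" "reachable (matrix_graph P) j k"
  shows "reachable (matrix_graph P) i k"
  using assms unfolding reachable_def
  by (auto simp: matrix_graph_def intro: converse_rtrancl_on_into_rtrancl_on)

lemma reachable_matrix_graph_refl [simp]: "reachable (matrix_graph P) i i"
  by (simp add: reachable_def matrix_graph_def)

lemma reachable_matrix_graph_trans:
  assumes "reachable (matrix_graph P) i j" "reachable (matrix_graph P) j k"
  shows "reachable (matrix_graph P) i k"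
  using assms unfolding reachable_def by (rule rtrancl_on_trans)

lemma reachable_matrix_graph_arc:
  "P $ i $ j > 0 \<Longrightarrow> reachable (matrix_graph P) i j"
  by (blast intro: reachable_matrix_graph_step reachable_matrix_graph_refl)

lemma matrix_classes_eq:
  "matrix_classes P =
    range (\<lambda>i. {j. reachable (matrix_graph P) i j \<and> reachable (matrix_graph P) j i})"
  by (auto simp: matrix_classes_def quotient_def)

lemma matrix_classesE:
  assumes "K \<in> matrix_classes P" "i \<in> K"
  shows "K = {j. reachable (matrix_graph P) i j \<and> reachable (matrix_graph P) j i}"
  using assms by (auto simp: matrix_classes_eq intro: reachable_matrix_graph_trans)

text \<open>Positivity travels against the arcs: for an arc from \<open>x\<close> to
  \<open>y\<close>, the positive term \<open>P $ x $ y * W $ y\<close> belongs to a nonnegative sum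
  bounded by \<open>W $ x\<close>.\<close>

lemma superharmonic_positive_upstream:
  fixes P :: "real^'n^'n::finite"
  assumes "0 \<le> P" "P *v W \<le> W" "0 \<le> W"
    and "reachable (matrix_graph P) j i" "W $ i > 0"
  shows "W $ j > 0"
  using assms(4,5) unfolding reachable_def
proof (induction rule: converse_rtrancl_on_induct)
  case (step x y)
  then have "0 < P $ x $ y * W $ y"
    by (auto simp: matrix_graph_def)
  also have "\<dots> \<le> (\<Sum>k\<in>UNIV. P $ x $ k * W $ k)"
    using assms(1,3) by (intro member_le_sum) (auto simp: vec_le_iff)
  also have "\<dots> \<le> W $ x"
    using assms(2) by (simp add: vec_le_iff matrix_vector_mult_def)
  finally show ?case .
qed

text \<open>For a stable nonnegative \<open>P\<close>, a class \<open>K\<close> is critical iff it carries such a \<open>y\<close>; this replaces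
  Perron--Frobenius eigenvectors throughout.\<close>

definition critical_witness :: "real^'n^'n::finite \<Rightarrow> 'n set \<Rightarrow> real^'n \<Rightarrow> bool" where
  "critical_witness P K y \<longleftrightarrow>
     0 \<le> y \<and> y \<noteq> 0 \<and> (\<forall>i. i \<notin> K \<longrightarrow> y $ i = 0) \<and> y \<le> P *v y"

text \<open>If \<open>P *v z\<close> were smaller than \<open>z\<close> somewhere on \<open>K\<close>, then \<open>W = z - lim P^k z\<close> would be
  positive on \<open>K\<close>, hence above a multiple of \<open>y\<close>; but \<open>P^k W\<close> tends to 0 while \<open>P^k y \<ge> y\<close>.\<close>

lemma superharmonic_eq_on_class:
  fixes P :: "real^'n^'n::finite"
  assumes P: "0 \<le> P" "stable P" and K: "K \<in> matrix_classes P" "critical_witness P K y"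
    and z: "P *v z \<le> z" and i: "i \<in> K"
  shows "(P *v z) $ i = z $ i"
proof (rule ccontr)
  assume "(P *v z) $ i \<noteq> z $ i"
  then have lt: "(P *v z) $ i < z $ i"
    using z by (auto simp: vec_le_iff order_less_le)
  obtain z' where z': "(\<lambda>k. ((*v) P ^^ k) z) \<longlonglongrightarrow> z'" "P *v z' = z'" "z' \<le> z"
    using superharmonic_converges[OF P z] .
  define W where "W = z - z'"
  have W: "0 \<le> W" "P *v W \<le> W"
    using z z' by (auto simp: W_def matrix_vector_mult_diff_distrib vec_le_iff)
  \<comment> \<open>Hence \<open>W $ i\<close> is at least \<open>z $ i - (P *v z) $ i\<close>,
    which is positive.\<close>
  have "z' \<le> P *v z"
    using matrix_vector_mono[OF P(1) z'(3)] z'(2) by simp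
  then have "W $ i > 0"
    using lt by (force simp: W_def vec_le_iff dest!: spec[of _ i])
  then have Wpos: "W $ j > 0" if "j \<in> K" for j
    using superharmonic_positive_upstream[OF P(1) W(2,1)] matrix_classesE[OF K(1) i] that
    by blast
  have fix_pow: "((*v) P ^^ k) z' = z'" for k
    by (induction k) (use z' in auto)
  have "((*v) P ^^ k) W = ((*v) P ^^ k) z - z'" for k
    by (simp add: W_def linear_diff[OF linear_iterate] fix_pow)
  then have "(\<lambda>k. ((*v) P ^^ k) W) \<longlonglongrightarrow> 0"
    using tendsto_diff[OF z'(1) tendsto_const[of z']] by simp
  have y: "0 \<le> y" "y \<noteq> 0" "\<And>i. i \<notin> K \<Longrightarrow> y $ i = 0" "y \<le> P *v y"
    using K(2) by (auto simp: critical_witness_def)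
  \<comment> \<open>The constant is the minimum of \<open>W\<close> on \<open>K\<close> divided by
    \<open>b + 1\<close>, with \<open>b\<close> the maximum of \<open>y\<close> on \<open>K\<close>;
    adding 1 keeps the denominator positive.\<close>
  have "\<exists>c>0. c *\<^sub>R y \<le> W"
  proof -
    define m where "m = Min ((\<lambda>j. W $ j) ` K)"
    define b where "b = Max ((\<lambda>j. y $ j) ` K)"
    have "K \<noteq> {}" using i by blast
    then have m: "m > 0" "\<And>j. j \<in> K \<Longrightarrow> m \<le> W $ j"
      using i Wpos by (auto simp: m_def Min_gr_iff)
    have b: "\<And>j. j \<in> K \<Longrightarrow> y $ j \<le> b"
      by (auto simp: b_def)
    have b0: "0 \<le> b"
      using b[OF i] y(1) by (metis vec_le_iff order_trans zero_index)
    have "m / (b + 1) * y $ j \<le> W $ j" for j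
    proof (cases "j \<in> K")
      case True
      have "m / (b + 1) * y $ j \<le> m / (b + 1) * (b + 1)"
        using m(1) b0 b[OF True] by (intro mult_left_mono) auto
      then show ?thesis using m(2)[OF True] b0 by simp
    next
      case False
      then show ?thesis using W(1) y(3) by (simp add: vec_le_iff)
    qed
    then show ?thesis
      using m(1) b0 by (intro exI[of _ "m / (b + 1)"]) (auto simp: vec_le_iff)
  qed
  then obtain c where c: "c > 0" "c *\<^sub>R y \<le> W" by blast
  have "c *\<^sub>R y \<le> ((*v) P ^^ k) W" for k
  proof (induction k)
    case (Suc k)
    have "c *\<^sub>R y \<le> P *v (c *\<^sub>R y)"
      using y(4) c(1) by (simp add: matrix_vector_mult_scaleR vec_le_iff)
    also have "\<dots> \<le> P *v (((*v) P ^^ k) W)"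
      by (rule matrix_vector_mono[OF P(1) Suc])
    finally show ?case by simp
  qed (use c in simp)
  then have "c * y $ j \<le> 0" for j
    using tendsto_vec_nth[OF \<open>(\<lambda>k. ((*v) P ^^ k) W) \<longlonglongrightarrow> 0\<close>, of j]
    by (intro tendsto_lowerbound[where F = sequentially]) (auto simp: vec_le_iff)
  then have "y \<le> 0"
    using c(1) by (auto simp: vec_le_iff mult_le_0_iff)
  then show False using y(1,2) by order
qed

text \<open>The negative part \<open>q\<close> of \<open>z\<close> is subharmonic, so both \<open>z\<close> and \<open>q\<close>, and with them \<open>z + q\<close>, are
  harmonic on \<open>K\<close>: the positive and the negative part can be treated separately.\<close>

lemma superharmonic_zero_propagates:
  fixes P :: "real^'n^'n::finite"
  assumes P: "0 \<le> P" "stable P" and K: "K \<in> matrix_classes P" "critical_witness P K y"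
    and z: "P *v z \<le> z" and i: "i \<in> K" "z $ i = 0" and j: "P $ i $ j > 0"
  shows "z $ j = 0"
proof -
  define q where "q = (\<chi> k. max 0 (- z $ k))"
  have qk: "q $ k = max 0 (- z $ k)" for k by (simp add: q_def)
  then have q0: "0 \<le> q" and zq: "- q \<le> z" by (auto simp: vec_le_iff)
  have "- (P *v q) \<le> P *v z"
    using matrix_vector_mono[OF P(1) zq] by (simp add: matrix_vector_mult_minus)
  moreover have "- (P *v q) \<le> 0"
    using matrix_vector_mono[OF P(1) q0] by (simp add: vec_le_iff)
  \<comment> \<open>Each component of \<open>P *v q\<close> is at least that of \<open>- z\<close>
    and at least 0, hence at least that of \<open>q\<close>.\<close>
  ultimately have sub: "P *v (- q) \<le> - q"
    using z qk by (simp add: vec_le_iff matrix_vector_mult_minus) (smt (verit))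
  \<comment> \<open>A zero sum of nonnegative terms has only zero terms. This is applied to the
    negative part \<open>q\<close> and to the positive part \<open>z + q\<close>.\<close>
  have vanish: "x $ j = 0" if x: "0 \<le> x" "(P *v x) $ i = 0" for x
  proof -
    have "P $ i $ j * x $ j = 0"
      using x P(1) by (auto simp: matrix_vector_mult_def vec_le_iff sum_nonneg_eq_0_iff)
    then show ?thesis using j by simp
  qed
  have eq: "(P *v (- q)) $ i = 0" "(P *v z) $ i = 0"
    using superharmonic_eq_on_class[OF P K sub i(1)] superharmonic_eq_on_class[OF P K z i(1)]
      i(2) by (auto simp: q_def)
  then have "q $ j = 0" 
    using vanish[OF q0] by (simp add: matrix_vector_mult_minus)
  moreover have "(z + q) $ j = 0"
    using eq by (intro vanish)
      (auto simp: matrix_vector_mult_minus matrix_vector_right_distrib vec_le_iff qk)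
  ultimately show ?thesis by simp
qed

section \<open>Critical classes and the spectral radius\<close>

lemma sum_bij_index:
  fixes n :: nat
  assumes "bij_betw e {0..<n} K"
  shows "(\<Sum>b<n. g (e b)) = (\<Sum>j\<in>K. g j)"
  using sum.reindex_bij_betw[OF assms, of g] by (simp add: lessThan_atLeast0)

lemma principal_submatrix_enum:
  fixes P :: "real^'n^'n::finite"
  obtains e where "bij_betw e {0..<card K} K"
    "principal_submatrix P K = Matrix.mat (card K) (card K) (\<lambda>(a, b). complex_of_real (P $ e a $ e b))"
proof -
  let ?e = "SOME e. bij_betw e {0..<card K} K"
  have "bij_betw ?e {0..<card K} K"
    using someI_ex[OF ex_bij_betw_nat_finite[OF finite[of K]]] .
  then show ?thesis
    using that[of ?e] by (simp add: principal_submatrix_def Let_def)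
qed

text \<open>Take the moduli of an eigenvector and extend by zero outside \<open>K\<close>; the
  triangle inequality turns the eigenvalue equation into this inequality.\<close>

lemma eigenvalue_principal_submatrix_subharmonic:
  fixes P :: "real^'n^'n::finite"
  assumes P: "0 \<le> P" and ev: "eigenvalue (principal_submatrix P K) \<mu>"
  shows "\<exists>y. 0 \<le> y \<and> y \<noteq> 0 \<and> (\<forall>i. i \<notin> K \<longrightarrow> y $ i = 0) \<and> norm \<mu> *\<^sub>R y \<le> P *v y"
proof -
  let ?n = "card K"
  obtain e where e: "bij_betw e {0..<?n} K" and
    A: "principal_submatrix P K = Matrix.mat ?n ?n (\<lambda>(a, b). complex_of_real (P $ e a $ e b))"
    using principal_submatrix_enum .
  obtain x where x: "x \<in> carrier_vec ?n" "x \<noteq> 0\<^sub>v ?n" "principal_submatrix P K *\<^sub>v x = \<mu> \<cdot>\<^sub>v x"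
    using ev by (auto simp: eigenvalue_def eigenvector_def A)
  define y :: "real^'n" where
    "y = (\<chi> i. if i \<in> K then norm (vec_index x (inv_into {0..<?n} e i)) else 0)"
  have eK: "e a \<in> K" if "a < ?n" for a
    using e that by (auto simp: bij_betw_def)
  have ye: "y $ e a = norm (vec_index x a)" if "a < ?n" for a
    using eK[OF that] bij_betw_inv_into_left[OF e, of a] that by (simp add: y_def)
  have y0: "0 \<le> y" by (simp add: y_def vec_le_iff)
  have supp: "y $ i = 0" if "i \<notin> K" for i using that by (simp add: y_def)
  obtain a where "a < ?n" "vec_index x a \<noteq> 0"
    using x(1,2) by (metis carrier_vecD eq_vecI index_zero_vec)
  then have "y \<noteq> 0"
    using ye[of a] by force
  have "norm \<mu> * y $ i \<le> (P *v y) $ i" for i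
  proof (cases "i \<in> K")
    case True
    then obtain a where a: "a < ?n" "i = e a"
      using e unfolding bij_betw_def by (metis atLeastLessThan_iff imageE)
    have "\<mu> * vec_index x a = vec_index (principal_submatrix P K *\<^sub>v x) a"
      using x a(1) by simp
    also have "\<dots> = (\<Sum>b<?n. complex_of_real (P $ i $ e b) * vec_index x b)"
      using x(1) a by (simp add: A scalar_prod_def atLeast0LessThan)
    finally have "norm \<mu> * y $ i = norm (\<Sum>b<?n. complex_of_real (P $ i $ e b) * vec_index x b)"
      by (metis a ye norm_mult)
    also have "\<dots> \<le> (\<Sum>b<?n. norm (complex_of_real (P $ i $ e b) * vec_index x b))"
      by (rule norm_sum)
    also have "\<dots> = (\<Sum>b<?n. P $ i $ e b * y $ e b)"
      using P by (intro sum.cong) (auto simp: norm_mult ye vec_le_iff)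
    also have "\<dots> = (\<Sum>j\<in>K. P $ i $ j * y $ j)"
      by (rule sum_bij_index[OF e])
    also have "\<dots> = (P *v y) $ i"
      unfolding matrix_vector_mult_def by (simp add: supp sum.mono_neutral_left)
    finally show ?thesis .
  next
    case False
    then show ?thesis
      using matrix_vector_mono[OF P y0] by (simp add: supp vec_le_iff)
  qed
  then show ?thesis
    using y0 \<open>y \<noteq> 0\<close> supp by (intro exI[of _ y]) (simp add: vec_le_iff)
qed

lemma eigenvalue_one_principal_submatrix:
  fixes P :: "real^'n^'n::finite"
  assumes y: "y \<noteq> 0" "\<And>i. i \<notin> K \<Longrightarrow> y $ i = 0" "\<And>i. i \<in> K \<Longrightarrow> (P *v y) $ i = y $ i"
  shows "eigenvalue (principal_submatrix P K) 1"
proof -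
  let ?n = "card K"
  obtain e where e: "bij_betw e {0..<?n} K" and
    A: "principal_submatrix P K = Matrix.mat ?n ?n (\<lambda>(a, b). complex_of_real (P $ e a $ e b))"
    using principal_submatrix_enum .
  define x where "x = Matrix.vec ?n (\<lambda>a. complex_of_real (y $ e a))"
  have "\<exists>i. y $ i \<noteq> 0" using y(1) by (simp add: Finite_Cartesian_Product.vec_eq_iff)
  then obtain i where i: "y $ i \<noteq> 0" by blast
  then have "i \<in> K" using y(2) by blast
  then obtain a where a: "a < ?n" "i = e a"
    using e unfolding bij_betw_def by (metis atLeastLessThan_iff imageE)
  have "vec_index x a \<noteq> 0" using a i by (simp add: x_def)
  then have "x \<noteq> 0\<^sub>v ?n" using a(1) by auto
  moreover have "principal_submatrix P K *\<^sub>v x = 1 \<cdot>\<^sub>v x"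
  proof (rule eq_vecI)
    fix a assume "a < dim_vec (1 \<cdot>\<^sub>v x)"
    then have a: "a < ?n" by (simp add: x_def)
    then have eK: "e a \<in> K" using e by (auto simp: bij_betw_def)
    have "vec_index (principal_submatrix P K *\<^sub>v x) a
        = complex_of_real (\<Sum>b<?n. P $ e a $ e b * y $ e b)"
      using a by (simp add: A x_def scalar_prod_def atLeast0LessThan)
    also have "(\<Sum>b<?n. P $ e a $ e b * y $ e b) = (\<Sum>j\<in>K. P $ e a $ j * y $ j)"
      by (rule sum_bij_index[OF e])
    also have "\<dots> = (P *v y) $ e a"
      unfolding matrix_vector_mult_def by (simp add: y(2) sum.mono_neutral_left)
    also have "\<dots> = y $ e a" by (rule y(3)[OF eK])
    finally show "vec_index (principal_submatrix P K *\<^sub>v x) a = vec_index (1 \<cdot>\<^sub>v x) a"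
      using a by (simp add: x_def)
  qed (simp add: x_def A)
  ultimately show ?thesis
    by (auto simp: eigenvalue_def eigenvector_def A x_def intro!: exI[of _ x])
qed

text \<open>The moduli of an eigenvector for an eigenvalue of modulus 1 form a witness. Conversely,
  a witness forces the eigenvalue 1, and stability of \<open>P\<close> bounds the modulus of every
  eigenvalue by 1.\<close>

lemma critical_class_iff_witness:
  fixes P :: "real^'n^'n::finite"
  assumes P: "0 \<le> P" "stable P" and K: "K \<noteq> {}"
  shows "spectral_radius (principal_submatrix P K) = 1 \<longleftrightarrow> (\<exists>y. critical_witness P K y)"
proof
  let ?A = "principal_submatrix P K"
  have A: "?A \<in> carrier_mat (card K) (card K)" and n: "card K > 0"
    using K by (auto simp: principal_submatrix_def Let_def card_gt_0_iff)
  {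
    assume "spectral_radius ?A = 1"
    then obtain \<mu> where "eigenvalue ?A \<mu>" "norm \<mu> = 1"
      using spectral_radius_mem_max(1)[OF A n] by (auto simp: spectrum_def)
    then show "\<exists>y. critical_witness P K y"
      using eigenvalue_principal_submatrix_subharmonic[OF P(1)]
      unfolding critical_witness_def by (metis scaleR_one)
  }
  assume "\<exists>y. critical_witness P K y"
  then obtain y where y: "0 \<le> y" "y \<noteq> 0" "\<And>i. i \<notin> K \<Longrightarrow> y $ i = 0" "y \<le> P *v y"
    by (auto simp: critical_witness_def)
  \<comment> \<open>Cutting \<open>P\<close> down to the block makes the fixed vector
    \<open>z\<close> below \<open>- y\<close> vanish outside \<open>K\<close>, so that it restricts
    to an eigenvector of the block.\<close>
  define Q where "Q = (\<chi> i j. if i \<in> K \<and> j \<in> K then P $ i $ j else 0)"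
  have Q: "0 \<le> Q" "Q \<le> P" using P by (auto simp: Q_def vec_le_iff)
  have Qx: "(Q *v x) $ i = (if i \<in> K then (P *v x) $ i else 0)" if "\<And>i. i \<notin> K \<Longrightarrow> x $ i = 0" for x i
    using that by (auto simp: matrix_vector_mult_def Q_def intro!: sum.cong)
  have "stable Q" by (rule stable_submatrix[OF P(2) Q])
  moreover have "Q *v (- y) \<le> - y"
    using y by (auto simp: matrix_vector_mult_minus vec_le_iff Qx)
  ultimately obtain z where z: "Q *v z = z" "z \<le> - y"
    using superharmonic_converges[OF Q(1)] by blast
  have zK: "z $ i = 0" if "i \<notin> K" for i
  proof -
    have "(Q *v z) $ i = 0" using that by (simp add: matrix_vector_mult_def Q_def)
    then show ?thesis by (simp add: z)
  qed
  have "z \<noteq> 0" using y z by force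
  then have "eigenvalue ?A 1"
    using zK Qx[of z] z(1) by (intro eigenvalue_one_principal_submatrix[of z]) auto
  then have "1 \<le> spectral_radius ?A"
    using spectral_radius_mem_max(2)[OF A n, of 1] by (force simp: spectrum_def)
  moreover have "spectral_radius ?A \<le> 1"
  proof -
    obtain \<mu> where \<mu>: "eigenvalue ?A \<mu>" "norm \<mu> = spectral_radius ?A"
      using spectral_radius_mem_max(1)[OF A n] by (auto simp: spectrum_def)
    obtain x where x: "0 \<le> x" "x \<noteq> 0" "norm \<mu> *\<^sub>R x \<le> P *v x"
      using eigenvalue_principal_submatrix_subharmonic[OF P(1) \<mu>(1)] by blast
    \<comment> \<open>An orbit of \<open>P\<close> dominates the powers of the modulus, which are
      therefore bounded.\<close>
    have pow: "norm \<mu> ^ k *\<^sub>R x \<le> ((*v) P ^^ k) x" for k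
    proof (induction k)
      case (Suc k)
      have "norm \<mu> ^ Suc k *\<^sub>R x \<le> norm \<mu> ^ k *\<^sub>R (P *v x)"
        using scaleR_left_mono[OF x(3), of "norm \<mu> ^ k"] by (simp add: mult.commute)
      also have "\<dots> = P *v (norm \<mu> ^ k *\<^sub>R x)" by (simp add: matrix_vector_mult_scaleR)
      also have "\<dots> \<le> P *v (((*v) P ^^ k) x)" by (rule matrix_vector_mono[OF P(1) Suc])
      finally show ?case by simp
    qed simp
    have "\<exists>i. x $ i \<noteq> 0" using x(2) by (simp add: Finite_Cartesian_Product.vec_eq_iff)
    then obtain i where i: "x $ i > 0" using x(1) by (auto simp: vec_le_iff order_less_le)
    obtain B where B: "\<And>k i. \<bar>(((*v) P ^^ k) x) $ i\<bar> \<le> B"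
      using stable_bound[OF P(2)] by blast
    have "norm \<mu> ^ k \<le> B / x $ i" for k
    proof -
      have "norm \<mu> ^ k * x $ i \<le> (((*v) P ^^ k) x) $ i"
        using pow[of k] by (simp add: vec_le_iff)
      also have "\<dots> \<le> B" using B[of k i] by simp
      finally show ?thesis using i by (simp add: field_simps)
    qed
    then have "norm \<mu> \<le> 1"
      by (metis real_arch_pow not_less)
    then show ?thesis using \<mu>(2) by simp
  qed
  ultimately show "spectral_radius ?A = 1" by simp
qed

section \<open>Critical nodes described by witnesses\<close>

lemma matrix_classes_nonempty: "K \<in> matrix_classes P \<Longrightarrow> K \<noteq> {}"
  by (auto simp: matrix_classes_eq intro: reachable_matrix_graph_refl)

lemma critical_nodes_iff:
  fixes P :: "real^'n^'n::finite"
  assumes "0 \<le> P" "stable P"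
  shows "i \<in> critical_nodes P \<longleftrightarrow> (\<exists>K y. K \<in> matrix_classes P \<and> i \<in> K \<and> critical_witness P K y)"
proof -
  have "critical_classes P = {K \<in> matrix_classes P. \<exists>y. critical_witness P K y}"
    using critical_class_iff_witness[OF assms matrix_classes_nonempty]
    by (auto simp: critical_classes_def)
  then show ?thesis by (auto simp: critical_nodes_def)
qed

text \<open>A minimum principle. The negative part \<open>q\<close> of \<open>z\<close> satisfies
  \<open>q \<le> P *v q\<close>; its restriction to a final class of its support keeps this
  inequality and makes the class critical, although \<open>z\<close> is nonzero there.\<close>

lemma superharmonic_nonneg:
  fixes P :: "real^'n^'n::finite"
  assumes P: "0 \<le> P" "stable P" and z: "P *v z \<le> z"
    and crit: "\<And>i. i \<in> critical_nodes P \<Longrightarrow> z $ i = 0"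
  shows "0 \<le> z"
proof (rule ccontr)
  assume neg: "\<not> 0 \<le> z"
  define q where "q = (\<chi> k. max 0 (- z $ k))"
  have qk: "q $ k = max 0 (- z $ k)" for k by (simp add: q_def)
  have Pq: "q $ k \<le> (P *v q) $ k" for k
  proof -
    have "- q \<le> z" "0 \<le> q" by (auto simp: vec_le_iff qk)
    then have "- (P *v q) $ k \<le> (P *v z) $ k" "0 \<le> (P *v q) $ k"
      using matrix_vector_mono[OF P(1), of "- q" z] matrix_vector_mono[OF P(1), of 0 q]
      by (auto simp: matrix_vector_mult_minus vec_le_iff)
    moreover have "(P *v z) $ k \<le> z $ k" using z by (simp add: vec_le_iff)
    ultimately show ?thesis by (simp add: qk)
  qed
  let ?r = "reachable (matrix_graph P)"
  define T where "T = {i. q $ i > 0}"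
  have "T \<noteq> {}" using neg by (auto simp: T_def qk vec_le_iff not_le less_max_iff_disj)
  \<comment> \<open>a final class of the support of \<open>q\<close>; restricting \<open>q\<close> to it gives a critical witness\<close>
  then obtain i where i: "i \<in> T" "\<And>j. j \<in> T \<Longrightarrow> ?r i j \<Longrightarrow> ?r j i"
  proof -
    \<comment> \<open>Choose \<open>i\<close> with access to as few support nodes as possible. If it
      reaches a support node \<open>j\<close>, then \<open>?R j\<close> is all of
      \<open>?R i\<close> and so contains \<open>i\<close>.\<close>
    let ?R = "\<lambda>i. {j \<in> T. ?r i j}"
    obtain i where "i \<in> T" and min: "\<And>j. j \<in> T \<Longrightarrow> card (?R i) \<le> card (?R j)"
      using \<open>T \<noteq> {}\<close> ex_has_least_nat[of "\<lambda>i. i \<in> T" _ "\<lambda>i. card (?R i)"] by blast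
    have "?r j i" if j: "j \<in> T" "?r i j" for j
    proof -
      have "?R j \<subseteq> ?R i" using j reachable_matrix_graph_trans by blast
      then have "?R j = ?R i" using min[OF j(1)] by (intro card_seteq) auto
      then show ?thesis using \<open>i \<in> T\<close> reachable_matrix_graph_refl by blast
    qed
    then show ?thesis using that \<open>i \<in> T\<close> by blast
  qed
  define K where "K = {j. ?r i j \<and> ?r j i}"
  define y where "y = (\<chi> j. if j \<in> K then q $ j else 0)"
  have K: "K \<in> matrix_classes P" "i \<in> K"
    by (auto simp: matrix_classes_eq K_def intro: reachable_matrix_graph_refl)
  have y0: "0 \<le> y" by (auto simp: y_def qk vec_le_iff)
  have "y $ k \<le> (P *v y) $ k" for k
  proof (cases "k \<in> K \<and> k \<in> T")
    case True
    \<comment> \<open>Restricting \<open>q\<close> to \<open>K\<close> loses no term: a support node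
      with an arc from \<open>k\<close> is accessible from \<open>i\<close>, so it leads back to
      \<open>i\<close> and lies in \<open>K\<close>.\<close>
    have "P $ k $ j * q $ j = P $ k $ j * y $ j" for j
    proof (cases "P $ k $ j > 0 \<and> q $ j > 0")
      case pos: True
      then have "?r i j"
        using True reachable_matrix_graph_trans reachable_matrix_graph_arc unfolding K_def by blast
      then have "j \<in> K" using i(2) pos by (auto simp: T_def K_def)
      then show ?thesis by (simp add: y_def)
    next
      case False
      moreover have "0 \<le> P $ k $ j" "0 \<le> q $ j" using P(1) by (auto simp: vec_le_iff qk)
      ultimately have "P $ k $ j = 0 \<or> q $ j = 0" by linarith
      then show ?thesis by (auto simp: y_def)
    qed
    then have "(P *v q) $ k = (P *v y) $ k"
      unfolding matrix_vector_mult_def vec_lambda_beta by (rule sum.cong[OF refl])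
    then show ?thesis using True Pq[of k] by (simp add: y_def)
  next
    case False
    then have "y $ k = 0" by (auto simp: y_def T_def qk)
    then show ?thesis using matrix_vector_mono[OF P(1) y0] by (simp add: vec_le_iff)
  qed
  moreover have "y $ i > 0" using i(1) K(2) by (simp add: y_def T_def)
  then have "y \<noteq> 0" by auto
  ultimately have "critical_witness P K y"
    using y0 by (auto simp: critical_witness_def vec_le_iff y_def)
  then have "i \<in> critical_nodes P" using critical_nodes_iff[OF P] K by blast
  then show False using crit i(1) by (force simp: T_def qk)
qed

text \<open>The common rows keep a critical class of \<open>P\<close> strongly connected in the
  graph of \<open>Q\<close>, so it lies in one class of \<open>Q\<close>, where the same vector is
  again a witness.\<close>

lemma critical_nodes_same_rows:
  fixes P Q :: "real^'n^'n::finite"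
  assumes P: "0 \<le> P" "stable P" and Q: "0 \<le> Q" "stable Q"
    and rows: "\<And>i. i \<in> critical_nodes P \<Longrightarrow> Q $ i = P $ i"
  shows "critical_nodes P \<subseteq> critical_nodes Q"
proof
  fix i assume "i \<in> critical_nodes P"
  then obtain K y where K: "K \<in> matrix_classes P" "i \<in> K" "critical_witness P K y"
    using critical_nodes_iff[OF P] by blast
  have crit: "K \<subseteq> critical_nodes P" using K critical_nodes_iff[OF P] by blast
  have y: "0 \<le> y" "y \<noteq> 0" "\<And>i. i \<notin> K \<Longrightarrow> y $ i = 0" "y \<le> P *v y"
    using K(3) by (auto simp: critical_witness_def)
  have reach: "reachable (matrix_graph Q) j k" if "j \<in> K" "k \<in> K" for j k
  proof -
    have "reachable (matrix_graph P) j k"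
      using matrix_classesE[OF K(1) that(1)] that(2) by blast
    then show ?thesis
      using that(1) unfolding reachable_def
    proof (induction rule: converse_rtrancl_on_induct)
      case base
      then show ?case by (simp add: matrix_graph_def)
    next
      case (step x x')
      have Pxx: "P $ x $ x' > 0" using step.hyps(1) by (simp add: matrix_graph_def)
      have "reachable (matrix_graph P) x' k"
        using step.hyps(2) by (simp add: reachable_def)
      moreover have "reachable (matrix_graph P) k x"
        using matrix_classesE[OF K(1) that(2)] step.prems by blast
      \<comment> \<open>A path between two nodes of a class stays inside it: \<open>x'\<close> is
        reached from \<open>x\<close> and leads back to \<open>x\<close> through
        \<open>k\<close>.\<close>
      ultimately have "x' \<in> K"
        using matrix_classesE[OF K(1) step.prems] reachable_matrix_graph_arc[OF Pxx]
          reachable_matrix_graph_trans by blast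
      then have "reachable (matrix_graph Q) x' k"
        using step.IH by (simp add: reachable_def)
      moreover have "Q $ x $ x' > 0" using Pxx rows crit step.prems by auto
      ultimately show ?case
        using reachable_matrix_graph_step[of Q x x' k] by (simp add: reachable_def)
    qed
  qed
  define K' where "K' = {j. reachable (matrix_graph Q) i j \<and> reachable (matrix_graph Q) j i}"
  have "K' \<in> matrix_classes Q" by (auto simp: matrix_classes_eq K'_def)
  moreover have "i \<in> K'" by (auto simp: K'_def intro: reachable_matrix_graph_refl)
  moreover have "K \<subseteq> K'" using reach K(2) by (auto simp: K'_def)
  moreover have "y $ k \<le> (Q *v y) $ k" for k
  proof (cases "k \<in> K")
    case True
    then have "(Q *v y) $ k = (P *v y) $ k"
      using rows crit by (auto simp: matrix_vector_mult_def)
    then show ?thesis using y(4) by (simp add: vec_le_iff)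
  next
    case False
    then show ?thesis using matrix_vector_mono[OF Q(1) y(1)] y(3) by (simp add: vec_le_iff)
  qed
  then have "y \<le> Q *v y" by (simp add: vec_le_iff)
  then have "critical_witness Q K' y"
    using y \<open>K \<subseteq> K'\<close> by (auto simp: critical_witness_def)
  ultimately show "i \<in> critical_nodes Q"
    using critical_nodes_iff[OF Q] by blast
qed

section \<open>Subdifferentials of convex monotone maps\<close>

text \<open>A hyperplane separates \<open>(v, f v)\<close> from the strict epigraph. Openness of
  \<open>D\<close> excludes a vertical one, and rescaling the normal vector gives the
  subgradient.\<close>

lemma convex_on_ex_subgradient:
  fixes f :: "'a::euclidean_space \<Rightarrow> real"
  assumes D: "open D" "convex D" and f: "convex_on D f" and v: "v \<in> D"
  shows "\<exists>g. \<forall>x\<in>D. f v + inner g (x - v) \<le> f x"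
proof -
  let ?E = "{(x, t). x \<in> D \<and> f x < t}"
  have "convex ?E"
  proof (rule convexI, clarsimp)
    fix x y s t and a b :: real
    assume *: "x \<in> D" "f x < s" "y \<in> D" "f y < t" "0 \<le> a" "0 \<le> b" "a + b = 1"
    have "f (a *\<^sub>R x + b *\<^sub>R y) \<le> a * f x + b * f y"
      using f * by (auto simp: convex_on_def)
    also have "\<dots> < a * s + b * t"
    proof (cases "a = 0")
      case True
      then show ?thesis using * by simp
    next
      case False
      then show ?thesis using *
        by (intro add_less_le_mono mult_strict_left_mono mult_left_mono) auto
    qed
    finally show "a *\<^sub>R x + b *\<^sub>R y \<in> D \<and> f (a *\<^sub>R x + b *\<^sub>R y) < a * s + b * t"
      using D(2) * by (auto simp: convex_def)
  qed
  moreover have "(v, f v + 1) \<in> ?E" using v by simp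
  ultimately obtain p c where pc: "p \<noteq> 0" "inner p (v, f v) \<le> c" "\<And>q. q \<in> ?E \<Longrightarrow> c \<le> inner p q"
    using separating_hyperplane_sets[of "{(v, f v)}" ?E] by fastforce
  obtain a \<alpha> where p: "p = (a, \<alpha>)" by fastforce
  have ineq: "inner a v + \<alpha> * f v \<le> inner a x + \<alpha> * t" if "x \<in> D" "f x < t" for x t
    using pc(2) pc(3)[of "(x, t)"] that by (auto simp: p)
  have "\<alpha> \<ge> 0"
    using ineq[OF v, of "f v + 1"] by (simp add: algebra_simps)
  have "\<alpha> \<noteq> 0"
  proof
    assume \<alpha>: "\<alpha> = 0"
    have le: "inner a v \<le> inner a x" if "x \<in> D" for x
      using ineq[OF that, of "f x + 1"] \<alpha> by simp
    obtain e where e: "e > 0" "ball v e \<subseteq> D"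
      using D(1) v open_contains_ball by blast
    have "a \<noteq> 0" using pc(1) \<alpha> p by (simp add: zero_prod_def)
    \<comment> \<open>Moving a distance \<open>e / 2\<close> from \<open>v\<close> against the
      normal stays in \<open>D\<close> but lowers the inner product with \<open>a\<close>.\<close>
    define x where "x = v - (e / (2 * norm a)) *\<^sub>R a"
    have "x \<in> ball v e" using e \<open>a \<noteq> 0\<close> by (simp add: x_def dist_norm)
    then have "inner a v \<le> inner a x" using e le by blast
    then have "(e / (2 * norm a)) * inner a a \<le> 0" by (simp add: x_def inner_diff_right)
    moreover have "0 < (e / (2 * norm a)) * inner a a"
      using e \<open>a \<noteq> 0\<close> by simp
    ultimately show False by simp
  qed
  with \<open>\<alpha> \<ge> 0\<close> have \<alpha>: "\<alpha> > 0" by simp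
  have "f v + inner ((- 1 / \<alpha>) *\<^sub>R a) (x - v) \<le> f x" if x: "x \<in> D" for x
  proof (rule field_le_epsilon)
    \<comment> \<open>The graph of \<open>f\<close> lies outside the strict epigraph, so the
      inequality is used at height \<open>f x + e\<close>.\<close>
    fix e :: real assume "e > 0"
    then have "inner a v + \<alpha> * f v \<le> inner a x + \<alpha> * (f x + e)"
      using ineq[OF x] by simp
    then show "f v + inner ((- 1 / \<alpha>) *\<^sub>R a) (x - v) \<le> f x + e"
      using \<alpha> by (simp add: field_simps inner_diff_right)
  qed
  then show ?thesis by blast
qed

text \<open>Membership is a condition on each row separately, so subgradients of the coordinate
  functions can be stacked.\<close>

lemma subdifferential_nonempty:
  fixes D :: "(real^'n::finite) set"
  assumes "open D" "convex D" "convex_map_on D f" "v \<in> D"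
  obtains M where "M \<in> subdifferential D f v"
proof -
  have "\<exists>g. \<forall>x\<in>D. f v $ i + inner g (x - v) \<le> f x $ i" for i
    using assms by (intro convex_on_ex_subgradient) (auto simp: convex_map_on_def)
  then obtain g where g: "\<And>i x. x \<in> D \<Longrightarrow> f v $ i + inner (g i) (x - v) \<le> f x $ i"
    by metis
  have "(\<chi> i. g i) \<in> subdifferential D f v"
    using g by (auto simp: subdifferential_def vec_le_iff matrix_vector_mul_component algebra_simps)
  then show ?thesis using that by blast
qed

text \<open>Difference quotients of a convex function decrease as the step shrinks; the bound
  \<open>c\<close> makes their infimum finite, and it is the limit.\<close>

lemma convex_dir_deriv:
  fixes f :: "'a::real_normed_vector \<Rightarrow> real"
  assumes D: "open D" "convex D" and f: "convex_on D f" and v: "v \<in> D"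
    and lb: "\<And>e. e > 0 \<Longrightarrow> v + e *\<^sub>R y \<in> D \<Longrightarrow> c * e \<le> f (v + e *\<^sub>R y) - f v"
  shows "\<exists>l. ((\<lambda>e. (f (v + e *\<^sub>R y) - f v) / e) \<longlongrightarrow> l) (at_right 0) \<and> c \<le> l"
proof -
  let ?q = "\<lambda>e. (f (v + e *\<^sub>R y) - f v) / e"
  have "((\<lambda>e. v + e *\<^sub>R y) \<longlongrightarrow> v + 0 *\<^sub>R y) (at_right 0)"
    by (intro tendsto_intros)
  then have "\<forall>\<^sub>F e in at_right 0. v + e *\<^sub>R y \<in> D"
    using D(1) v by (intro topological_tendstoD) auto
  then obtain b where b: "b > 0" "\<And>e. 0 < e \<Longrightarrow> e < b \<Longrightarrow> v + e *\<^sub>R y \<in> D"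
    unfolding eventually_at_right_field by auto
  have mono: "?q s \<le> ?q t" if "0 < s" "s \<le> t" "t < b" for s t
  proof -
    have "v + s *\<^sub>R y = (1 - s / t) *\<^sub>R v + (s / t) *\<^sub>R (v + t *\<^sub>R y)"
      using that by (simp add: algebra_simps)
    then have "f (v + s *\<^sub>R y) \<le> (1 - s / t) * f v + (s / t) * f (v + t *\<^sub>R y)"
      using convex_onD[OF f, of "s / t" v "v + t *\<^sub>R y"] that v b(2) by simp
    then show ?thesis
      using that by (simp add: field_simps)
  qed
  have lbq: "c \<le> ?q e" if "0 < e" "e < b" for e
    using lb[of e] b(2)[of e] that by (simp add: field_simps)
  define l where "l = Inf (?q ` {0<..<b})"
  have bdd: "bdd_below (?q ` {0<..<b})"
    using lbq by (intro bdd_belowI[of _ c]) auto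
  have "(?q \<longlongrightarrow> l) (at_right 0)"
  proof (rule order_tendstoI)
    fix a assume "a < l"
    have "a < ?q e" if "0 < e" "e < b" for e
      using \<open>a < l\<close> that cInf_lower[OF _ bdd, of "?q e"] by (auto simp: l_def)
    then show "\<forall>\<^sub>F e in at_right 0. a < ?q e"
      using b(1) unfolding eventually_at_right_field by blast
  next
    fix a assume "l < a"
    then obtain t where t: "0 < t" "t < b" "?q t < a"
      using b(1) bdd by (auto simp: l_def cInf_less_iff)
    have "?q e < a" if "0 < e" "e < t" for e
      using mono[of e t] that t by simp
    then show "\<forall>\<^sub>F e in at_right 0. ?q e < a"
      using t(1) unfolding eventually_at_right_field by blast
  qed
  moreover have "c \<le> l"
    unfolding l_def using b(1) lbq by (intro cInf_greatest) auto
  ultimately show ?thesis by blast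
qed

text \<open>The subgradient inequality bounds every difference quotient below by
  \<open>M *v y\<close>. The coordinate limits exist, so \<open>Lim\<close> denotes the genuine
  limit.\<close>

lemma subdifferential_le_dir_deriv:
  fixes D :: "(real^'n::finite) set"
  assumes D: "open D" "convex D" and f: "convex_map_on D f" and v: "v \<in> D"
    and M: "M \<in> subdifferential D f v"
  shows "M *v y \<le> dir_deriv f v y"
proof -
  have lb: "(M *v y) $ i * e \<le> f (v + e *\<^sub>R y) $ i - f v $ i" if "v + e *\<^sub>R y \<in> D" for e i
    using M that
    by (fastforce simp: subdifferential_def vec_le_iff matrix_vector_mult_scaleR mult.commute)
  let ?lim = "\<lambda>i l. ((\<lambda>e. (f (v + e *\<^sub>R y) $ i - f v $ i) / e) \<longlongrightarrow> l) (at_right 0)"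
  have "\<forall>i. \<exists>l. ?lim i l \<and> (M *v y) $ i \<le> l"
  proof
    fix i
    have "convex_on D (\<lambda>x. f x $ i)" using f by (simp add: convex_map_on_def)
    then show "\<exists>l. ?lim i l \<and> (M *v y) $ i \<le> l" by (rule convex_dir_deriv[OF D _ v lb])
  qed
  from choice[OF this] obtain l where l: "\<And>i. ?lim i (l i)" "\<And>i. (M *v y) $ i \<le> l i"
    by blast
  have "((\<lambda>e. (f (v + e *\<^sub>R y) - f v) /\<^sub>R e) \<longlongrightarrow> (\<chi> i. l i)) (at_right 0)"
    using l(1) by (intro vec_tendstoI) (simp add: divide_inverse mult.commute)
  then have "dir_deriv f v y = (\<chi> i. l i)"
    unfolding dir_deriv_def by (intro tendsto_Lim) auto
  then show ?thesis using l(2) by (simp add: vec_le_iff)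
qed

text \<open>Test the subgradient inequality slightly below \<open>v\<close> in coordinate
  \<open>j\<close>: \<open>f\<close> does not exceed \<open>f v\<close> there, so column
  \<open>j\<close> of \<open>M\<close> is nonnegative.\<close>

lemma subdifferential_nonneg:
  fixes D :: "(real^'n::finite) set"
  assumes D: "open D" and f: "mono_on D f" and v: "v \<in> D"
    and M: "M \<in> subdifferential D f v"
  shows "0 \<le> M"
proof -
  have "0 \<le> M $ i $ j" for i j
  proof -
    have "((\<lambda>e::real. v - e *\<^sub>R axis j 1) \<longlongrightarrow> v - 0 *\<^sub>R axis j 1) (at_right 0)"
      by (intro tendsto_intros)
    then have "\<forall>\<^sub>F e in at_right 0. v - e *\<^sub>R axis j (1::real) \<in> D"
      using D v by (intro topological_tendstoD) auto
    then obtain e :: real where e: "e > 0" "v - e *\<^sub>R axis j 1 \<in> D"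
      unfolding eventually_at_right_field by (meson field_lbound_gt_zero dense)
    have "v - e *\<^sub>R axis j 1 \<le> v"
      using e(1) by (auto simp: vec_le_iff axis_def)
    then have "f (v - e *\<^sub>R axis j 1) \<le> f v"
      using f e v by (auto simp: mono_on_def)
    moreover have "M *v ((v - e *\<^sub>R axis j 1) - v) \<le> f (v - e *\<^sub>R axis j 1) - f v"
      using M e(2) by (auto simp: subdifferential_def)
    moreover have "(v - e *\<^sub>R axis j 1) - v = - (e *\<^sub>R axis j 1)"
      by simp
    ultimately have "M *v (- (e *\<^sub>R axis j 1)) \<le> 0"
      by (metis diff_le_0_iff_le order_trans)
    then have "(M *v ((- e) *\<^sub>R axis j 1)) $ i \<le> 0"
      by (simp add: vec_le_iff)
    then show ?thesis
      using e(1) by (simp only: matrix_vector_mult_scaleR)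
        (simp add: matrix_vector_mult_basis column_def zero_le_mult_iff)
  qed
  then show ?thesis by (simp add: vec_le_iff)
qed

text \<open>Orbits of \<open>M\<close> lie below those of \<open>dir_deriv\<close>, which gives
  upper bounds only; linearity of \<open>M\<close> turns the upper bound for \<open>- y\<close> into
  a lower bound for \<open>y\<close>.\<close>

lemma subdifferential_stable:
  fixes D :: "(real^'n::finite) set"
  assumes D: "open D" "convex D" and f: "convex_map_on D f" "mono_on D f"
    and v: "t_stable_fixed_point D f v"
    and M: "M \<in> subdifferential D f v"
  shows "stable M"
proof (rule stableI)
  fix y
  have vD: "v \<in> D" and bdd: "\<And>y. bdd_above (range (\<lambda>k. (dir_deriv f v ^^ k) y))"
    using v by (auto simp: t_stable_fixed_point_def)
  have "((*v) M ^^ k) x \<le> (dir_deriv f v ^^ k) x" for k x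
  proof (induction k)
    case (Suc k)
    have "M *v (((*v) M ^^ k) x) \<le> M *v ((dir_deriv f v ^^ k) x)"
      by (rule matrix_vector_mono[OF subdifferential_nonneg[OF D(1) f(2) vD M] Suc])
    also have "\<dots> \<le> dir_deriv f v ((dir_deriv f v ^^ k) x)"
      by (rule subdifferential_le_dir_deriv[OF D f(1) vD M])
    finally show ?case by simp
  qed simp
  moreover have "\<exists>b. \<forall>k. (dir_deriv f v ^^ k) x \<le> b" for x
    using bdd[of x] by (auto simp: bdd_above_def)
  ultimately have ub: "\<exists>b. \<forall>k. ((*v) M ^^ k) x \<le> b" for x
    by (meson order_trans)
  obtain b c where b: "\<And>k. ((*v) M ^^ k) y \<le> b" and c: "\<And>k. ((*v) M ^^ k) (- y) \<le> c"
    using ub by metis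
  have c': "- (((*v) M ^^ k) y) \<le> c" for k
    using c[of k] by (simp add: linear_neg linear_iterate)
  have bc: "\<bar>(((*v) M ^^ k) y) $ i\<bar> \<le> max (b $ i) (c $ i)" for k i
  proof -
    have "(((*v) M ^^ k) y) $ i \<le> b $ i" "- (((*v) M ^^ k) y) $ i \<le> c $ i"
      using b[of k] c'[of k] by (auto simp: vec_le_iff)
    then show ?thesis by linarith
  qed
  have "\<bar>(((*v) M ^^ k) y) $ i\<bar> \<le> Max (range (\<lambda>i. max (b $ i) (c $ i)))" for k i
    by (rule order_trans[OF bc[of k i] Max_ge]) auto
  then show "\<exists>B. \<forall>k i. \<bar>(((*v) M ^^ k) y) $ i\<bar> \<le> B" by blast
qed

section \<open>The critical graph at t-stable fixed points\<close>

context
  fixes D :: "(real^'n::finite) set" and f :: "real^'n \<Rightarrow> real^'n"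
  assumes D: "open D" "convex D" and f: "convex_map_on D f" "mono_on D f"
begin

lemma subdifferential_nonneg_stable:
  assumes "t_stable_fixed_point D f v" "M \<in> subdifferential D f v"
  shows "0 \<le> M" "stable M"
proof -
  have v: "v \<in> D" using assms(1) by (simp add: t_stable_fixed_point_def)
  show "0 \<le> M" by (rule subdifferential_nonneg[OF D(1) f(2) v assms(2)])
  show "stable M" by (rule subdifferential_stable[OF D f assms])
qed

text \<open>This is the subgradient inequality at \<open>v\<close> tested at \<open>w\<close>, since
  \<open>f w - f v\<close> equals \<open>w - v\<close>.\<close>

lemma subdifferential_superharmonic:
  assumes "t_stable_fixed_point D f v" "t_stable_fixed_point D f w" "M \<in> subdifferential D f v"
  shows "M *v (w - v) \<le> w - v"
proof -
  have "f v = v" "f w = w" "w \<in> D"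
    using assms(1,2) by (auto simp: t_stable_fixed_point_def)
  then show ?thesis using assms(3) by (force simp: subdifferential_def)
qed

text \<open>Since \<open>P *v (v - u) = v - u\<close> on the critical nodes, those rows of \<open>P\<close> are subgradients
  at \<open>v\<close> as well.\<close>

lemma critical_graph_subset:
  assumes u: "t_stable_fixed_point D f u" and v: "t_stable_fixed_point D f v"
    and P: "P \<in> subdifferential D f u"
  shows "\<exists>Q \<in> subdifferential D f v. pverts (critical_graph P) \<subseteq> pverts (critical_graph Q)
    \<and> parcs (critical_graph P) \<subseteq> parcs (critical_graph Q)"
proof -
  note Pns = subdifferential_nonneg_stable[OF u P]
  have vD: "v \<in> D" "f v = v" and uD: "u \<in> D" "f u = u"
    using u v by (auto simp: t_stable_fixed_point_def)
  obtain Q0 where Q0: "Q0 \<in> subdifferential D f v"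
    using subdifferential_nonempty[OF D f(1) vD(1)] .
  define Q where "Q = (\<chi> i. if i \<in> critical_nodes P then P $ i else Q0 $ i)"
  have "(Q *v (x - v)) $ i \<le> (f x - f v) $ i" if x: "x \<in> D" for x i
  proof (cases "i \<in> critical_nodes P")
    case True
    then obtain K y where "K \<in> matrix_classes P" "i \<in> K" "critical_witness P K y"
      using critical_nodes_iff[OF Pns] by blast
    \<comment> \<open>Subtracting this equality from the subgradient inequality at \<open>u\<close>
      moves its base point to \<open>v\<close>, both points being fixed.\<close>
    then have "(P *v (v - u)) $ i = (v - u) $ i"
      using superharmonic_eq_on_class[OF Pns _ _ subdifferential_superharmonic[OF u v P]] by blast
    moreover have "(P *v (x - u)) $ i \<le> (f x - f u) $ i"
      using P x by (auto simp: subdifferential_def vec_le_iff)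
    moreover have "(Q *v (x - v)) $ i = (P *v (x - v)) $ i"
      using True by (simp add: Q_def matrix_vector_mult_def)
    moreover have "P *v (x - v) = P *v (x - u) - P *v (v - u)"
      by (simp flip: matrix_vector_mult_diff_distrib)
    ultimately show ?thesis using vD uD by simp
  next
    case False
    then have "(Q *v (x - v)) $ i = (Q0 *v (x - v)) $ i"
      by (simp add: Q_def matrix_vector_mult_def)
    then show ?thesis using Q0 x by (auto simp: subdifferential_def vec_le_iff)
  qed
  then have Q: "Q \<in> subdifferential D f v" by (simp add: subdifferential_def vec_le_iff)
  note Qns = subdifferential_nonneg_stable[OF v Q]
  have rows: "Q $ i = P $ i" if "i \<in> critical_nodes P" for i using that by (simp add: Q_def)
  have sub: "critical_nodes P \<subseteq> critical_nodes Q"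
    using critical_nodes_same_rows[OF Pns Qns rows] .
  then have "parcs (critical_graph P) \<subseteq> parcs (critical_graph Q)"
    using rows by (auto simp: critical_graph_def matrix_graph_def)
  moreover have "pverts (critical_graph P) \<subseteq> pverts (critical_graph Q)"
    using sub by (simp add: critical_graph_def)
  ultimately show ?thesis using Q by blast
qed

text \<open>\<open>critical_graph_subset\<close> gives one inclusion for any ordered pair of
  t-stable fixed points; exchanging them gives the other.\<close>

lemma critical_graph_map_eq:
  assumes u: "t_stable_fixed_point D f u" and v: "t_stable_fixed_point D f v"
  shows "critical_graph_map D f u = critical_graph_map D f v"
proof -
  have "pverts (critical_graph_map D f a) \<subseteq> pverts (critical_graph_map D f b)
      \<and> parcs (critical_graph_map D f a) \<subseteq> parcs (critical_graph_map D f b)"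
    if "t_stable_fixed_point D f a" "t_stable_fixed_point D f b" for a b
    unfolding critical_graph_map_def critical_graph_set_def pair_pre_digraph.select_convs
    by (intro conjI SUP_mono; use critical_graph_subset[OF that] in blast)
  note this[OF u v] this[OF v u]
  then show ?thesis
    by (intro pair_pre_digraph.equality subset_antisym) simp_all
qed

text \<open>Arcs of the critical graph may come from different subgradients, but
  \<open>w - v\<close> is superharmonic for each of them, so its zeros on \<open>S\<close> spread
  along all paths and reach every critical node.\<close>

lemma fixed_point_le:
  assumes v: "t_stable_fixed_point D f v" and w: "t_stable_fixed_point D f w"
    and S: "\<forall>C \<in> pre_digraph.sccs_verts (with_proj (critical_graph_map D f v)). S \<inter> C \<noteq> {}"
    and eq: "\<forall>i\<in>S. v $ i = w $ i"
  shows "v \<le> w"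
proof -
  let ?G = "with_proj (critical_graph_map D f v)"
  have arc: "(w - v) $ j = 0" 
    if ij: "(i, j) \<in> parcs (critical_graph_map D f v)" and i: "(w - v) $ i = 0" for i j
  proof -
    obtain P where P: "P \<in> subdifferential D f v" "i \<in> critical_nodes P" "P $ i $ j > 0"
      using ij by (auto simp: critical_graph_map_def critical_graph_set_def critical_graph_def matrix_graph_def)
    note Pns = subdifferential_nonneg_stable[OF v P(1)]
    obtain K y where "K \<in> matrix_classes P" "i \<in> K" "critical_witness P K y"
      using critical_nodes_iff[OF Pns] P(2) by blast
    then show ?thesis
      using superharmonic_zero_propagates[OF Pns _ _ subdifferential_superharmonic[OF v w P(1)] _ i P(3)]
      by blast
  qed
  have reach: "(w - v) $ j = 0" if "reachable ?G i j" "(w - v) $ i = 0" for i j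
    using that(1) unfolding reachable_def
    by (induction rule: rtrancl_on_induct) (use that(2) arc in auto)
  obtain P where P: "P \<in> subdifferential D f v"
    using subdifferential_nonempty[OF D f(1)] v by (auto simp: t_stable_fixed_point_def)
  have "0 \<le> w - v"
  proof (rule superharmonic_nonneg[OF subdifferential_nonneg_stable[OF v P]
        subdifferential_superharmonic[OF v w P]])
    fix i assume "i \<in> critical_nodes P"
    \<comment> \<open>A node reaches itself in this graph only if it is a vertex, which holds for
      critical nodes.\<close>
    then have i: "reachable ?G i i"
      using P by (auto simp: reachable_def critical_graph_map_def critical_graph_set_def critical_graph_def)
    have trans: "reachable ?G a c" if "reachable ?G a b" "reachable ?G b c" for a b c
      using that unfolding reachable_def by (rule rtrancl_on_trans)
    define C where "C = {j. reachable ?G i j \<and> reachable ?G j i}"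
    have "C \<in> pre_digraph.sccs_verts ?G"
      unfolding pre_digraph.sccs_verts_def C_def using i trans by blast
    then obtain s where s: "s \<in> S" "s \<in> C" using S by blast
    then show "(w - v) $ i = 0" using reach[of s i] eq by (auto simp: C_def)
  qed
  then show ?thesis by simp
qed

end

theorem theorem5p3:
  fixes D :: "(real^'n::finite) set" and f :: "real^'n \<Rightarrow> real^'n"
  assumes "open D" and "convex D" and "f ` D \<subseteq> D"
    and "convex_map_on D f" and "mono_on D f"
  shows "(\<forall>u v w S.
            t_stable_fixed_point D f u \<longrightarrow>
            t_stable_fixed_point D f v \<longrightarrow>
            t_stable_fixed_point D f w \<longrightarrow>
            (\<forall>C \<in> pre_digraph.sccs_verts (with_proj (critical_graph_map D f u)). S \<inter> C \<noteq> {}) \<longrightarrow>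
            (\<forall>i\<in>S. v $ i = w $ i) \<longrightarrow>
            v = w)
       \<and> (\<forall>u. t_stable_fixed_point D f u \<longrightarrow> critical_nodes_map D f u = {} \<longrightarrow>
            (\<exists>!v. t_stable_fixed_point D f v))"
proof -
  note ctx = assms(1,2,4,5)
  have uniq: "v = w"
    if u: "t_stable_fixed_point D f u" and v: "t_stable_fixed_point D f v"
      and w: "t_stable_fixed_point D f w"
      and S: "\<forall>C \<in> pre_digraph.sccs_verts (with_proj (critical_graph_map D f u)). S \<inter> C \<noteq> {}"
      and eq: "\<forall>i\<in>S. v $ i = w $ i" for u v w S
  proof (rule antisym)
    \<comment> \<open>The condition on \<open>S\<close> refers to the graph at \<open>u\<close>;
      independence of the fixed point transfers it to \<open>v\<close>, and below to
      \<open>w\<close>.\<close>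
    show "v \<le> w"
      using fixed_point_le[OF ctx v w] S eq critical_graph_map_eq[OF ctx u v] by simp
    show "w \<le> v"
      using fixed_point_le[OF ctx w v] S eq critical_graph_map_eq[OF ctx u w] by simp
  qed
  have "\<exists>!v. t_stable_fixed_point D f v"
    if u: "t_stable_fixed_point D f u" and "critical_nodes_map D f u = {}" for u
  proof -
    have "pverts (critical_graph_map D f u) = {}"
      using that(2) by (simp add: critical_nodes_map_def critical_nodes_set_def
          critical_graph_map_def critical_graph_set_def critical_graph_def)
    \<comment> \<open>A component is nonempty and its nodes reach themselves, so they are vertices.
      Without vertices, the empty set is an admissible \<open>S\<close>.\<close>
    then have "pre_digraph.sccs_verts (with_proj (critical_graph_map D f u)) = {}"
      using in_rtrancl_on_in_F(1) by (fastforce simp: pre_digraph.sccs_verts_def reachable_def)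
    then show ?thesis using uniq[OF u, of _ _ "{}"] u by auto
  qed
  then show ?thesis using uniq by blast
qed

end
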